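(* Let $A_1,A_2,A_3,A_4$ be the vertices of a quadrilateral and let $g_1,g_2,g_3,g_4$ be lines such that for each $i\in\{1,2,3,4\}$, $g_i$ passes through $A_i$. Then the following statements are equivalent: (i) $$\frac{A_1D_2}{D_2A_3}\cdot\frac{A_2D_3}{D_3A_4}\cdot\frac{A_3D_4}{D_4A_1}\cdot\frac{A_4D_1}{D_1A_2}=1,$$ where $D_i=g_i\times(A_{i-1}\times A_{i+1})$ for $i\in\{1,2,3,4\}$ (indices modulo 4). (ii) The points $g_1\times g_2$, $g_3\times g_4$, $(A_1\times A_4)\times(A_2\times A_3)$ are collinear. (iii) The points $g_1\times g_4$, $g_2\times g_3$, $(A_1\times A_2)\times(A_3\times A_4)$ are collinear.
   Context: The setting is the real projective plane, with $A_1,\dots,A_4$ in the affine (Euclidean) part, no three of them collinear. $A\times B$ is the line through distinct points $A,B$; $g\times h$ is the intersection point of distinct lines $g,h$. The lines $g_i$ are understood to be different from the side lines $A_j\times A_{j+1}$, so that all intersection points and fractions are defined. For collinear points, $\frac{AB}{CD}$ is the quotient of oriented lengths of segments on an oriented line; as usual $\frac{AX}{XB}=-1$ if $X$ is the point at infinity of the line $AB$. *)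

theory Defs
  imports "HOL-Analysis.Analysis"
begin

text \<open>
  The real projective plane: points and lines are the one- and two-dimensional
  linear subspaces of \<open>\<real>\<^sup>3\<close>, incidence is inclusion. The affine plane \<open>\<real>\<^sup>2\<close> sits in it
  through \<open>(x, y) \<mapsto> \<langle>(x, y, 1)\<rangle>\<close>, and the remaining points are those at infinity.
  Vertices and lines of a quadrilateral are indexed by the type \<open>4\<close> of integers modulo 4,
  whose elements are \<open>1, 2, 3, 4\<close> with \<open>4 = 0\<close>.
\<close>

typedef proj_point = "{S :: (real^3) set. subspace S \<and> dim S = 1}"
  by (metis (mono_tags, lifting) dim_singleton dim_span mem_Collect_eq subspace_span zero_neq_one)

typedef proj_line = "{S :: (real^3) set. subspace S \<and> dim S = 2}"
proof -
  have "dim (UNIV :: (real^3) set) = 3" by simp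
  then obtain S :: "(real^3) set" where "subspace S" "dim S = 2"
    using choose_subspace_of_subspace[of 2 "UNIV :: (real^3) set"] by auto
  then show ?thesis by blast
qed

definition on_line :: "proj_point \<Rightarrow> proj_line \<Rightarrow> bool" where
  "on_line P l \<longleftrightarrow> Rep_proj_point P \<subseteq> Rep_proj_line l"

definition join :: "proj_point \<Rightarrow> proj_point \<Rightarrow> proj_line" where
  "join P Q = (THE l. on_line P l \<and> on_line Q l)"

definition meet :: "proj_line \<Rightarrow> proj_line \<Rightarrow> proj_point" where
  "meet l m = (THE P. on_line P l \<and> on_line P m)"

definition proj_collinear :: "proj_point set \<Rightarrow> bool" where
  "proj_collinear S \<longleftrightarrow> (\<exists>l. \<forall>P\<in>S. on_line P l)"

definition aff :: "real^2 \<Rightarrow> proj_point" where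
  "aff p = Abs_proj_point (span {vector [p $ 1, p $ 2, 1]})"

definition oriented_length :: "real^2 \<Rightarrow> real^2 \<Rightarrow> real^2 \<Rightarrow> real" where
  "oriented_length u P Q = (Q - P) \<bullet> u"

text \<open>
  The quotient \<open>AX / XB\<close> for \<open>A \<noteq> B\<close> and a projective point \<open>X \<noteq> B\<close> on the line \<open>AB\<close>. The
  line is oriented by the unit vector from \<open>A\<close> to \<open>B\<close>; the opposite orientation changes
  the sign of both lengths, hence gives the same quotient. At the point at infinity of \<open>AB\<close>
  the quotient is \<open>-1\<close> by convention.
\<close>

definition ratio :: "real^2 \<Rightarrow> proj_point \<Rightarrow> real^2 \<Rightarrow> real" where
  "ratio A X B =
     (if X \<in> range aff
      then let p = inv aff X; u = sgn (B - A)
           in oriented_length u A p / oriented_length u p B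
      else -1)"


lemma Rep_proj_point_span:
  obtains x where "x \<noteq> 0" "Rep_proj_point P = span {x}"
proof -
  have P: "subspace (Rep_proj_point P)" "dim (Rep_proj_point P) = 1"
    using Rep_proj_point[of P] by auto
  then obtain B where B: "B \<subseteq> Rep_proj_point P" "independent B"
      "Rep_proj_point P \<subseteq> span B" "card B = 1"
    by (metis basis_exists)
  then obtain x where x: "B = {x}" by (meson card_1_singletonE)
  have "span B = Rep_proj_point P"
    using B P by (meson span_minimal subset_antisym)
  moreover have "x \<noteq> 0" using B x by (auto simp: dependent_zero)
  ultimately show ?thesis using that x by blast
qed

lemma join_unique:
  assumes "P \<noteq> Q"
  shows "\<exists>!l. on_line P l \<and> on_line Q l"
proof -
  obtain x where x: "x \<noteq> 0" "Rep_proj_point P = span {x}" by (rule Rep_proj_point_span)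
  obtain y where y: "y \<noteq> 0" "Rep_proj_point Q = span {y}" by (rule Rep_proj_point_span)
  have ne: "span {x} \<noteq> span {y}"
    using assms x y by (metis Rep_proj_point_inject)
  have "y \<notin> span {x}"
  proof
    assume h: "y \<in> span {x}"
    then have "span {y} \<subseteq> span {x}" by (simp add: span_minimal)
    moreover have "dim (span {x}) \<le> dim (span {y})" using x y by simp
    ultimately have "span {y} = span {x}"
      by (intro subspace_dim_equal) auto
    then show False using ne by simp
  qed
  then have d: "dim {y, x} = 2" using x by (simp add: dim_insert)
  have sub: "span {x} \<subseteq> span {y, x}" "span {y} \<subseteq> span {y, x}"
    by (auto intro!: span_mono)
  let ?l = "Abs_proj_line (span {y, x})"
  have l: "Rep_proj_line ?l = span {y, x}"
    using d by (subst Abs_proj_line_inverse) auto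
  show ?thesis
  proof (rule ex1I[of _ ?l])
    show "on_line P ?l \<and> on_line Q ?l"
      unfolding on_line_def l using x y sub by auto
  next
    fix m assume m: "on_line P m \<and> on_line Q m"
    have M: "subspace (Rep_proj_line m)" "dim (Rep_proj_line m) = 2"
      using Rep_proj_line[of m] by auto
    have "{y, x} \<subseteq> Rep_proj_line m"
      using m x y unfolding on_line_def by (auto simp: span_base subset_iff)
    then have "span {y, x} \<subseteq> Rep_proj_line m" using M by (simp add: span_minimal)
    then have "span {y, x} = Rep_proj_line m"
      using M d by (intro subspace_dim_equal) auto
    then show "m = ?l" by (metis l Rep_proj_line_inject)
  qed
qed

lemma meet_unique:
  assumes "l \<noteq> m"
  shows "\<exists>!P. on_line P l \<and> on_line P m"
proof -
  let ?L = "Rep_proj_line l" and ?M = "Rep_proj_line m"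
  have L: "subspace ?L" "dim ?L = 2" using Rep_proj_line[of l] by auto
  have M: "subspace ?M" "dim ?M = 2" using Rep_proj_line[of m] by auto
  have ne: "?L \<noteq> ?M" using assms by (simp add: Rep_proj_line_inject)
  have I: "subspace (?L \<inter> ?M)" using L M by (simp add: subspace_inter)
  have "dim (?L \<inter> ?M) \<noteq> 2"
    using subspace_dim_equal[OF I L(1)] subspace_dim_equal[OF I M(1)] L M ne by force
  moreover have "dim (?L \<inter> ?M) \<le> 2" using L(2) dim_subset[of "?L \<inter> ?M" ?L] by simp
  moreover have "dim {x + y |x y. x \<in> ?L \<and> y \<in> ?M} \<le> 3"
    using dim_subset_UNIV[of "{x + y |x y. x \<in> ?L \<and> y \<in> ?M}"] by simp
  ultimately have d: "dim (?L \<inter> ?M) = 1"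
    using dim_sums_Int[OF L(1) M(1)] L M by linarith
  let ?P = "Abs_proj_point (?L \<inter> ?M)"
  have P: "Rep_proj_point ?P = ?L \<inter> ?M"
    using d I by (subst Abs_proj_point_inverse) auto
  show ?thesis
  proof (rule ex1I[of _ ?P])
    show "on_line ?P l \<and> on_line ?P m" unfolding on_line_def P by auto
  next
    fix Q assume "on_line Q l \<and> on_line Q m"
    then have "Rep_proj_point Q \<subseteq> ?L \<inter> ?M" unfolding on_line_def by auto
    moreover have "subspace (Rep_proj_point Q)" "dim (Rep_proj_point Q) = 1"
      using Rep_proj_point[of Q] by auto
    ultimately have "Rep_proj_point Q = ?L \<inter> ?M"
      using I d by (intro subspace_dim_equal) auto
    then show "Q = ?P" by (metis P Rep_proj_point_inject)
  qed
qed

lemma Rep_aff: "Rep_proj_point (aff p) = span {vector [p $ 1, p $ 2, 1]}"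
proof -
  have "(vector [p $ 1, p $ 2, 1] :: real^3) \<noteq> 0"
    by (metis vector_3(3) zero_index zero_neq_one)
  then show ?thesis unfolding aff_def by (subst Abs_proj_point_inverse) auto
qed

lemma inj_aff: "inj aff"
proof (rule injI)
  fix p q assume "aff p = aff q"
  then have "(vector [p $ 1, p $ 2, 1] :: real^3) \<in> span {vector [q $ 1, q $ 2, 1]}"
    by (metis Rep_aff span_base singletonI)
  then obtain k where k: "(vector [p $ 1, p $ 2, 1] :: real^3) = k *\<^sub>R vector [q $ 1, q $ 2, 1]"
    by (auto simp: span_singleton)
  have "(vector [p $ 1, p $ 2, 1] :: real^3) $ i = k * vector [q $ 1, q $ 2, 1] $ i" for i
    unfolding k by simp
  from this[of 1] this[of 2] this[of 3] show "p = q"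
    by (simp add: vec_eq_iff forall_2)
qed

lemma ratio_affine:
  assumes "A \<noteq> B"
  shows "ratio A (aff ((1 - t) *\<^sub>R A + t *\<^sub>R B)) B = t / (1 - t)"
proof -
  let ?u = "sgn (B - A)" and ?p = "(1 - t) *\<^sub>R A + t *\<^sub>R B"
  have n: "(B - A) \<bullet> ?u \<noteq> 0" using assms by (simp add: sgn_div_norm)
  have "?p - A = t *\<^sub>R (B - A)" "B - ?p = (1 - t) *\<^sub>R (B - A)"
    by (simp_all add: algebra_simps)
  then show ?thesis
    using n by (simp add: ratio_def oriented_length_def inv_f_f[OF inj_aff] Let_def)
qed

end

theory Submission
  imports Defs
begin

text \<open>
  Write \<open>a\<^sub>i\<close> for the homogeneous coordinate vector of the vertex \<open>A\<^sub>i\<close>, \<open>n\<^sub>i\<close> for a normal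
  vector of the plane representing \<open>g\<^sub>i\<close>, and \<open>m\<^sub>i\<^sub>j = n\<^sub>i \<bullet> a\<^sub>j\<close>. Then \<open>D\<^sub>i\<close> is spanned by
  \<open>n\<^sub>i \<times> (a\<^sub>i\<^sub>-\<^sub>1 \<times> a\<^sub>i\<^sub>+\<^sub>1)\<close>, so the ratio at \<open>D\<^sub>i\<close> is the quotient of \<open>- m\<^sub>i\<^sub>,\<^sub>i\<^sub>-\<^sub>1\<close> by \<open>m\<^sub>i\<^sub>,\<^sub>i\<^sub>+\<^sub>1\<close>,
  and (i) says that \<open>m\<^sub>1\<^sub>2 m\<^sub>2\<^sub>3 m\<^sub>3\<^sub>4 m\<^sub>4\<^sub>1 = m\<^sub>1\<^sub>4 m\<^sub>4\<^sub>3 m\<^sub>3\<^sub>2 m\<^sub>2\<^sub>1\<close>. The determinant of the three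
  points in (ii) is exactly the difference of these two products. Exchanging the indices
  2 and 4 preserves the condition up to its two sides and turns (ii) into (iii).
\<close>

unbundle cross3_syntax

section \<open>Points by spanning vectors, lines by normal vectors\<close>

lemma proj_line_normal:
  obtains n where "Rep_proj_line l = {x. n \<bullet> x = 0}"
proof -
  have l: "subspace (Rep_proj_line l)" "dim (Rep_proj_line l) = 2"
    using Rep_proj_line[of l] by auto
  then obtain n where n: "n \<noteq> 0" "span (Rep_proj_line l) \<subseteq> {x. n \<bullet> x = 0}"
    using lowdim_subset_hyperplane[of "Rep_proj_line l"] by auto
  have "Rep_proj_line l = {x. n \<bullet> x = 0}"
    using l n by (intro subspace_dim_equal) (simp_all add: subspace_hyperplane dim_hyperplane span_eq_iff[THEN iffD2])
  then show ?thesis by (rule that)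
qed

lemma normal_nonzero:
  assumes "Rep_proj_line l = {x. n \<bullet> x = 0}"
  shows "n \<noteq> 0"
proof
  assume "n = 0"
  then have "Rep_proj_line l = UNIV" using assms by simp
  then show False using Rep_proj_line[of l] by simp
qed

lemma obtain_line_with_normal:
  assumes "n \<noteq> 0"
  obtains l where "Rep_proj_line l = {x. n \<bullet> x = 0}"
proof -
  have "Rep_proj_line (Abs_proj_line {x. n \<bullet> x = 0}) = {x. n \<bullet> x = 0}"
    using assms by (intro Abs_proj_line_inverse) (simp add: subspace_hyperplane dim_hyperplane)
  then show ?thesis by (rule that)
qed

lemma generator_nonzero:
  assumes "Rep_proj_point P = span {x}"
  shows "x \<noteq> 0"
  using assms Rep_proj_point[of P] by auto

lemma obtain_point_with_generator:
  assumes "x \<noteq> 0"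
  obtains P where "Rep_proj_point P = span {x}"
proof -
  have "Rep_proj_point (Abs_proj_point (span {x})) = span {x}"
    using assms by (intro Abs_proj_point_inverse) simp
  then show ?thesis by (rule that)
qed

lemma on_line_iff:
  assumes "Rep_proj_point P = span {x}" and "Rep_proj_line l = {z. n \<bullet> z = 0}"
  shows "on_line P l \<longleftrightarrow> n \<bullet> x = 0"
proof
  assume "on_line P l"
  then show "n \<bullet> x = 0"
    using assms span_base[of x "{x}"] unfolding on_line_def by blast
next
  assume "n \<bullet> x = 0"
  then show "on_line P l"
    using assms by (auto simp: on_line_def span_singleton)
qed

text \<open>Proportional vectors span the same point and have the same orthogonal plane. Hence
  distinct points or distinct lines yield a nonzero cross product, which is how joins and meets
  become computable.\<close>

lemma cross3_eq_0_iff: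
  fixes x y :: "real^3"
  assumes "x \<noteq> 0" and "y \<noteq> 0"
  shows "x \<times> y = 0 \<longleftrightarrow> (\<exists>c. c \<noteq> 0 \<and> y = c *\<^sub>R x)"
  using assms by (auto simp: cross_eq_0 collinear_lemma)

lemma Rep_meet:
  assumes l: "Rep_proj_line l = {x. n \<bullet> x = 0}" and m: "Rep_proj_line m = {x. n' \<bullet> x = 0}"
    and "l \<noteq> m"
  shows "Rep_proj_point (meet l m) = span {n \<times> n'}"
proof -
  have "n \<times> n' \<noteq> 0"
  proof
    assume "n \<times> n' = 0"
    then obtain c where "c \<noteq> 0" "n' = c *\<^sub>R n"
      using cross3_eq_0_iff[OF normal_nonzero[OF l] normal_nonzero[OF m]] by blast
    then have "Rep_proj_line l = Rep_proj_line m" using l m by simp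
    then show False using \<open>l \<noteq> m\<close> by (simp add: Rep_proj_line_inject)
  qed
  then obtain P where P: "Rep_proj_point P = span {n \<times> n'}"
    by (rule obtain_point_with_generator)
  have "on_line P l \<and> on_line P m"
    by (simp add: on_line_iff[OF P l] on_line_iff[OF P m] dot_cross_self)
  then have "meet l m = P"
    unfolding meet_def using meet_unique[OF \<open>l \<noteq> m\<close>] by (intro the1_equality) auto
  with P show ?thesis by simp
qed

lemma Rep_join:
  assumes P: "Rep_proj_point P = span {x}" and Q: "Rep_proj_point Q = span {y}"
    and "P \<noteq> Q"
  shows "Rep_proj_line (join P Q) = {z. (x \<times> y) \<bullet> z = 0}"
proof -
  have "x \<times> y \<noteq> 0"
  proof
    assume "x \<times> y = 0"
    then obtain c where "c \<noteq> 0" "y = c *\<^sub>R x"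
      using cross3_eq_0_iff[OF generator_nonzero[OF P] generator_nonzero[OF Q]] by blast
    then have "span {x} = span {y}"
      using span_image_scale[of "{x}" "\<lambda>_. c"] by simp
    then show False using P Q \<open>P \<noteq> Q\<close> by (simp add: Rep_proj_point_inject[symmetric])
  qed
  then obtain l where l: "Rep_proj_line l = {z. (x \<times> y) \<bullet> z = 0}"
    by (rule obtain_line_with_normal)
  have "on_line P l \<and> on_line Q l"
    by (simp add: on_line_iff[OF P l] on_line_iff[OF Q l] dot_cross_self inner_commute)
  then have "join P Q = l"
    unfolding join_def using join_unique[OF \<open>P \<noteq> Q\<close>] by (intro the1_equality) auto
  with l show ?thesis by simp
qed

lemma join_eqI:
  assumes "P \<noteq> Q" and "on_line P l" and "on_line Q l"
  shows "l = join P Q"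
  unfolding join_def using assms join_unique[OF assms(1)] by (intro the1_equality[symmetric]) auto

lemma join_commute: "join P Q = join Q P"
  unfolding join_def by (simp add: conj_commute)

text \<open>A common line is a nonzero normal vector orthogonal to all three generators, that is, a
  kernel vector of the matrix with rows \<open>x\<close>, \<open>y\<close>, \<open>z\<close>. It
  exists exactly when the determinant of that matrix, the triple product, vanishes.\<close>

lemma proj_collinear_iff:
  assumes P: "Rep_proj_point P = span {x}" and Q: "Rep_proj_point Q = span {y}"
    and R: "Rep_proj_point R = span {z}"
  shows "proj_collinear {P, Q, R} \<longleftrightarrow> x \<bullet> (y \<times> z) = 0"
proof -
  let ?M = "vector [x, y, z] :: real^3^3"
  have rows: "?M *v n = 0 \<longleftrightarrow> n \<bullet> x = 0 \<and> n \<bullet> y = 0 \<and> n \<bullet> z = 0" for n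
    by (simp add: vec_eq_iff forall_3 matrix_vector_mult_def inner_vec_def sum_3 mult.commute)
  have "proj_collinear {P, Q, R} \<longleftrightarrow> (\<exists>n. n \<noteq> 0 \<and> n \<bullet> x = 0 \<and> n \<bullet> y = 0 \<and> n \<bullet> z = 0)"
  proof
    assume "proj_collinear {P, Q, R}"
    then obtain l where l: "on_line P l" "on_line Q l" "on_line R l"
      unfolding proj_collinear_def by auto
    obtain n where n: "Rep_proj_line l = {x. n \<bullet> x = 0}" by (rule proj_line_normal)
    show "\<exists>n. n \<noteq> 0 \<and> n \<bullet> x = 0 \<and> n \<bullet> y = 0 \<and> n \<bullet> z = 0"
      using l normal_nonzero[OF n]
      by (auto simp: on_line_iff[OF P n] on_line_iff[OF Q n] on_line_iff[OF R n])
  next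
    assume "\<exists>n. n \<noteq> 0 \<and> n \<bullet> x = 0 \<and> n \<bullet> y = 0 \<and> n \<bullet> z = 0"
    then obtain n where n: "n \<noteq> 0" "n \<bullet> x = 0" "n \<bullet> y = 0" "n \<bullet> z = 0" by blast
    then obtain l where l: "Rep_proj_line l = {x. n \<bullet> x = 0}"
      using obtain_line_with_normal by blast
    show "proj_collinear {P, Q, R}"
      unfolding proj_collinear_def using n
      by (intro exI[of _ l]) (simp add: on_line_iff[OF P l] on_line_iff[OF Q l] on_line_iff[OF R l])
  qed
  also have "\<dots> \<longleftrightarrow> x \<bullet> (y \<times> z) = 0"
    unfolding dot_cross_det rows[symmetric]
    using invertible_det_nz[of ?M] invertible_left_inverse[of ?M] matrix_left_invertible_ker[of ?M]
    by blast
  finally show ?thesis .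
qed

section \<open>Collinearity and ratios in homogeneous coordinates\<close>

definition homog :: "real^2 \<Rightarrow> real^3" where
  "homog p = vector [p $ 1, p $ 2, 1]"

lemma homog_nth [simp]: "homog p $ 1 = p $ 1" "homog p $ 2 = p $ 2" "homog p $ 3 = 1"
  by (simp_all add: homog_def)

lemma Rep_aff_homog: "Rep_proj_point (aff p) = span {homog p}"
  by (simp add: Rep_aff homog_def)

text \<open>As the third coordinates are all 1, the triple product is, up to sign, the 2-by-2
  determinant of the differences \<open>p - q\<close> and \<open>r - q\<close>.\<close>

lemma collinear_of_homog_triple:
  assumes "homog p \<bullet> (homog q \<times> homog r) = 0"
  shows "collinear {p, q, r}"
proof -
  define u v where "u = p - q" and "v = r - q"
  have uv: "u $ 1 * v $ 2 = u $ 2 * v $ 1"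
    using assms by (simp add: u_def v_def inner_vec_def sum_3 cross_components algebra_simps)
  have "u = 0 \<or> v = 0 \<or> (\<exists>c. v = c *\<^sub>R u)"
  proof (cases "u $ 1 = 0")
    case True
    then have "u = 0 \<or> v = (v $ 2 / u $ 2) *\<^sub>R u"
      using uv by (auto simp: vec_eq_iff forall_2)
    then show ?thesis by blast
  next
    case False
    then have "v = (v $ 1 / u $ 1) *\<^sub>R u"
      using uv by (auto simp: vec_eq_iff forall_2 field_simps)
    then show ?thesis by blast
  qed
  then have "collinear {0, u, v}" by (simp add: collinear_lemma)
  then show ?thesis using collinear_3[of p q r] by (simp add: u_def v_def)
qed

text \<open>The coefficients \<open>s\<close> and \<open>t\<close> act as masses at \<open>A\<close>
  and \<open>B\<close>. If their sum is nonzero, dividing by it gives an affine combination. If it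
  is zero, the third coordinate vanishes, so the point is at infinity, and \<open>t / s\<close> is
  -1 in agreement with the convention. The condition on \<open>s\<close> keeps the point away from
  \<open>B\<close>.\<close>

lemma ratio_homog:
  assumes "A \<noteq> B" and X: "Rep_proj_point X = span {s *\<^sub>R homog A + t *\<^sub>R homog B}" and "s \<noteq> 0"
  shows "ratio A X B = t / s"
proof (cases "s + t = 0")
  case True
  have "X \<notin> range aff"
  proof
    assume "X \<in> range aff"
    then obtain p where "Rep_proj_point X = span {homog p}" by (auto simp: Rep_aff_homog)
    then have "homog p \<in> span {s *\<^sub>R homog A + t *\<^sub>R homog B}"
      using X by (metis span_base singletonI)
    then obtain k where "homog p = k *\<^sub>R (s *\<^sub>R homog A + t *\<^sub>R homog B)"
      by (auto simp: span_singleton)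
    from arg_cong[OF this, of "\<lambda>v. v $ 3"] show False using True by simp
  qed
  moreover have "t / s = -1" using True \<open>s \<noteq> 0\<close> by (simp add: field_simps)
  ultimately show ?thesis by (simp add: ratio_def)
next
  case False
  define r where "r = t / (s + t)"
  have r: "1 - r = s / (s + t)" using False by (simp add: r_def field_simps)
  have "s *\<^sub>R homog A + t *\<^sub>R homog B = (s + t) *\<^sub>R homog ((1 - r) *\<^sub>R A + r *\<^sub>R B)"
    using False r by (simp add: vec_eq_iff forall_3 distrib_left r_def)
  then have "Rep_proj_point X = span {homog ((1 - r) *\<^sub>R A + r *\<^sub>R B)}"
    using X False span_image_scale[of "{homog ((1 - r) *\<^sub>R A + r *\<^sub>R B)}" "\<lambda>_. s + t"] by simp
  then have "X = aff ((1 - r) *\<^sub>R A + r *\<^sub>R B)"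
    by (simp add: Rep_aff_homog Rep_proj_point_inject[symmetric])
  then have "ratio A X B = r / (1 - r)"
    using ratio_affine[OF \<open>A \<noteq> B\<close>] by simp
  also have "\<dots> = t / s" unfolding r unfolding r_def using False by simp
  finally show ?thesis .
qed

text \<open>By Lagrange's formula, n x (a x b) = (n . b) a - (n . a) b, so the masses of the
  intersection point can be read off from the pairings of \<open>n\<close> with the two
  endpoints.\<close>

lemma ratio_meet_join:
  assumes l: "Rep_proj_line l = {x. n \<bullet> x = 0}" and "A \<noteq> B" and "n \<bullet> homog B \<noteq> 0"
  shows "ratio A (meet l (join (aff A) (aff B))) B = - (n \<bullet> homog A) / (n \<bullet> homog B)"
proof (rule ratio_homog[OF \<open>A \<noteq> B\<close> _ \<open>n \<bullet> homog B \<noteq> 0\<close>])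
  have ne: "aff A \<noteq> aff B" using \<open>A \<noteq> B\<close> inj_aff by (auto dest: injD)
  note j = Rep_join[OF Rep_aff_homog Rep_aff_homog ne]
  have "(homog A \<times> homog B) \<bullet> homog B = 0" by (simp add: dot_cross_self)
  then have "l \<noteq> join (aff A) (aff B)" using l j \<open>n \<bullet> homog B \<noteq> 0\<close> by auto
  from Rep_meet[OF l j this]
  show "Rep_proj_point (meet l (join (aff A) (aff B))) =
      span {(n \<bullet> homog B) *\<^sub>R homog A + (- (n \<bullet> homog A)) *\<^sub>R homog B}"
    by (simp add: Lagrange)
qed

section \<open>Polynomial identities for the determinant of the three points\<close>

lemma cramer_dot:
  fixes a b c d n :: "real^3"
  shows "(a \<bullet> (b \<times> c)) * (n \<bullet> d) =
    (d \<bullet> (b \<times> c)) * (n \<bullet> a) + (a \<bullet> (d \<times> c)) * (n \<bullet> b) + (a \<bullet> (b \<times> d)) * (n \<bullet> c)"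
  by (simp add: inner_vec_def sum_3 cross_components algebra_simps)

text \<open>Multiplicativity of the determinant: the right side expands, along its first row, the
  determinant of the matrix of inner products of \<open>x\<close>, \<open>y\<close>,
  \<open>z\<close> with \<open>a\<close>, \<open>b\<close>, \<open>c\<close>.\<close>

lemma triple_mult_triple:
  fixes x y z a b c :: "real^3"
  shows "(x \<bullet> (y \<times> z)) * (a \<bullet> (b \<times> c)) =
      (x \<bullet> a) * ((y \<bullet> b) * (z \<bullet> c) - (y \<bullet> c) * (z \<bullet> b))
    - (x \<bullet> b) * ((y \<bullet> a) * (z \<bullet> c) - (y \<bullet> c) * (z \<bullet> a))
    + (x \<bullet> c) * ((y \<bullet> a) * (z \<bullet> b) - (y \<bullet> b) * (z \<bullet> a))"
  by (simp add: inner_vec_def sum_3 cross_components algebra_simps)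

text \<open>The intersection of the lines \<open>ad\<close> and \<open>bc\<close> is written as a
  combination of \<open>d\<close> and \<open>a\<close>; the outer product is then linear in that
  vector.\<close>

lemma triple_of_meets:
  fixes w x y z a b c d :: "real^3"
  shows "(w \<times> x) \<bullet> ((y \<times> z) \<times> ((a \<times> d) \<times> (b \<times> c))) =
    (w \<bullet> (x \<times> z)) * ((a \<bullet> (b \<times> c)) * (y \<bullet> d) - (d \<bullet> (b \<times> c)) * (y \<bullet> a))
  - (w \<bullet> (x \<times> y)) * ((a \<bullet> (b \<times> c)) * (z \<bullet> d) - (d \<bullet> (b \<times> c)) * (z \<bullet> a))"
proof -
  have "(a \<times> d) \<times> (b \<times> c) = (a \<bullet> (b \<times> c)) *\<^sub>R d - (d \<bullet> (b \<times> c)) *\<^sub>R a"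
    unfolding cross_cross_det dot_cross_det[symmetric]
    by (simp add: vec_eq_iff forall_3 inner_vec_def sum_3 cross_components algebra_simps)
  moreover have "(w \<times> x) \<bullet> ((y \<times> z) \<times> v) = (w \<bullet> (x \<times> z)) * (y \<bullet> v) - (w \<bullet> (x \<times> y)) * (z \<bullet> v)" for v
    by (simp add: inner_vec_def sum_3 cross_components algebra_simps)
  ultimately show ?thesis by (simp add: inner_diff_right)
qed

text \<open>After multiplication by the nonzero determinant of \<open>a\<close>, \<open>b\<close>,
  \<open>c\<close>, the vector \<open>d\<close> can be eliminated by Cramer's rule and both sides
  become polynomials in pairings with \<open>a\<close>, \<open>b\<close>, \<open>c\<close>.\<close>

lemma meets_collinear_identity:
  fixes a b c d w x y z :: "real^3"
  assumes "a \<bullet> (b \<times> c) \<noteq> 0"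
    and "w \<bullet> a = 0" and "x \<bullet> b = 0" and "y \<bullet> c = 0" and "z \<bullet> d = 0"
  shows "(w \<times> x) \<bullet> ((y \<times> z) \<times> ((a \<times> d) \<times> (b \<times> c))) =
    (w \<bullet> b) * (x \<bullet> c) * (y \<bullet> d) * (z \<bullet> a) - (w \<bullet> d) * (z \<bullet> c) * (y \<bullet> b) * (x \<bullet> a)"
    (is "?L = ?R")
proof -
  define D where "D = a \<bullet> (b \<times> c)"
  define p where "p = d \<bullet> (b \<times> c)"
  define q where "q = a \<bullet> (d \<times> c)"
  define r where "r = a \<bullet> (b \<times> d)"
  define S where "S = w \<bullet> (x \<times> z)"
  define T where "T = w \<bullet> (x \<times> y)"
  have wd: "D * (w \<bullet> d) = q * (w \<bullet> b) + r * (w \<bullet> c)"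
    and yd: "D * (y \<bullet> d) = p * (y \<bullet> a) + q * (y \<bullet> b)"
    and zd: "0 = p * (z \<bullet> a) + q * (z \<bullet> b) + r * (z \<bullet> c)"
    using cramer_dot[of a b c w d] cramer_dot[of a b c y d] cramer_dot[of a b c z d] assms(2-5)
    by (simp_all add: D_def p_def q_def r_def)
  have S: "S * D = (w \<bullet> b) * ((x \<bullet> c) * (z \<bullet> a) - (x \<bullet> a) * (z \<bullet> c)) + (w \<bullet> c) * ((x \<bullet> a) * (z \<bullet> b))"
    and T: "T * D = (w \<bullet> b) * ((x \<bullet> c) * (y \<bullet> a)) + (w \<bullet> c) * ((x \<bullet> a) * (y \<bullet> b))"
    unfolding S_def T_def D_def triple_mult_triple using assms by (simp_all add: algebra_simps)
  have L: "?L = S * (D * (y \<bullet> d) - p * (y \<bullet> a)) + T * (p * (z \<bullet> a))"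
    unfolding triple_of_meets D_def p_def S_def T_def using assms by simp
  have "D * ?L = (S * D) * (q * (y \<bullet> b)) + (T * D) * (p * (z \<bullet> a))"
    unfolding L yd by (simp add: algebra_simps)
  \<comment> \<open>The terms with (w . b)(x . c)(z . a) combine by \<open>yd\<close>. In the
    others, \<open>zd\<close> replaces p (z . a) + q (z . b) by - r (z . c), after which
    \<open>wd\<close> applies.\<close>
  also have "\<dots> = D * ?R"
    unfolding S T using wd yd zd by algebra
  finally show ?thesis using assms(1) by (simp add: D_def)
qed

section \<open>The equivalences for the quadrilateral\<close>

theorem theorem13:
  fixes A :: "4 \<Rightarrow> real^2" and g :: "4 \<Rightarrow> proj_line" and D :: "4 \<Rightarrow> proj_point"
  assumes no_three_collinear:
      "\<And>i j k. i \<noteq> j \<Longrightarrow> j \<noteq> k \<Longrightarrow> i \<noteq> k \<Longrightarrow> \<not> collinear {A i, A j, A k}"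
    and through: "\<And>i. on_line (aff (A i)) (g i)"
    and not_side: "\<And>i j. g i \<noteq> join (aff (A j)) (aff (A (j + 1)))"
    and D: "\<And>i. D i = meet (g i) (join (aff (A (i - 1))) (aff (A (i + 1))))"
  shows "(ratio (A 1) (D 2) (A 3) * ratio (A 2) (D 3) (A 4) *
            ratio (A 3) (D 4) (A 1) * ratio (A 4) (D 1) (A 2) = 1
          \<longleftrightarrow> proj_collinear {meet (g 1) (g 2), meet (g 3) (g 4),
                meet (join (aff (A 1)) (aff (A 4))) (join (aff (A 2)) (aff (A 3)))})
       \<and> (proj_collinear {meet (g 1) (g 2), meet (g 3) (g 4),
                meet (join (aff (A 1)) (aff (A 4))) (join (aff (A 2)) (aff (A 3)))}
          \<longleftrightarrow> proj_collinear {meet (g 1) (g 4), meet (g 2) (g 3),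
                meet (join (aff (A 1)) (aff (A 2))) (join (aff (A 3)) (aff (A 4)))})"
proof -
  let ?a = "\<lambda>i. homog (A i)"
  have "\<exists>n. Rep_proj_line (g i) = {x. n \<bullet> x = 0}" for i
    using proj_line_normal[of "g i"] by blast
  then obtain n where n: "\<And>i. Rep_proj_line (g i) = {x. n i \<bullet> x = 0}" by metis
  have on_g: "on_line (aff p) (g i) \<longleftrightarrow> n i \<bullet> homog p = 0" for i p
    by (rule on_line_iff[OF Rep_aff_homog n])
  have na: "n i \<bullet> ?a i = 0" for i using through on_g by blast
  \<comment> \<open>Non-collinearity is assumed for triples only, so a third index is chosen:
    coinciding vertices would make the triple collinear.\<close>
  have A_ne: "A i \<noteq> A j" if ij: "i \<noteq> j" for i j
  proof -
    obtain k where "k \<noteq> i" "k \<noteq> j"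
    proof -
      have "card {i, j} < card (UNIV :: 4 set)" using ij by simp
      then have "{i, j} \<noteq> UNIV" by (metis less_irrefl)
      then show thesis using that by blast
    qed
    then have "\<not> collinear {A i, A j, A k}" using no_three_collinear ij by metis
    then show ?thesis by auto
  qed
  have aff_ne: "aff (A i) \<noteq> aff (A j)" if "i \<noteq> j" for i j
    using A_ne[OF that] inj_aff by (auto dest: injD)
  have triple: "?a i \<bullet> (?a j \<times> ?a k) \<noteq> 0" if "i \<noteq> j" "j \<noteq> k" "i \<noteq> k" for i j k
    using no_three_collinear[OF that] collinear_of_homog_triple by blast
  have side: "g i \<noteq> join (aff (A j)) (aff (A k))" if "k = j + 1 \<or> j = k + 1" for i j k
    using that not_side[of i] join_commute by metis
  \<comment> \<open>Otherwise \<open>g i\<close> would contain two adjacent vertices and be a side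
    line.\<close>
  have nz: "n i \<bullet> ?a j \<noteq> 0" if "j = i + 1 \<or> i = j + 1" "i \<noteq> j" for i j
    using join_eqI[OF aff_ne[OF that(2)], of "g i"] through[of i] on_g[of "A j" i] side[of j i i] that(1)
    by blast
  have g_ne: "g i \<noteq> g j" if "j = i + 1 \<or> i = j + 1" "i \<noteq> j" for i j
    using nz[OF that] na[of j] through[of j] on_g[of "A j" i] by auto
  have m: "Rep_proj_point (meet (g i) (g j)) = span {n i \<times> n j}"
    if "j = i + 1 \<or> i = j + 1" "i \<noteq> j" for i j
    by (rule Rep_meet[OF n n g_ne[OF that]])
  have s: "Rep_proj_point (meet (join (aff (A i)) (aff (A j))) (join (aff (A k)) (aff (A l)))) =
      span {(?a i \<times> ?a j) \<times> (?a k \<times> ?a l)}"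
    if "i \<noteq> j" "k \<noteq> l" "i \<noteq> k" "j \<noteq> k" for i j k l
  proof (rule Rep_meet)
    show 1: "Rep_proj_line (join (aff (A i)) (aff (A j))) = {x. (?a i \<times> ?a j) \<bullet> x = 0}"
      and 2: "Rep_proj_line (join (aff (A k)) (aff (A l))) = {x. (?a k \<times> ?a l) \<bullet> x = 0}"
      using that by (intro Rep_join Rep_aff_homog aff_ne; simp)+
    \<comment> \<open>The vertex \<open>A k\<close> lies on the second line but not on the first,
      which separates them.\<close>
    have "(?a i \<times> ?a j) \<bullet> ?a k \<noteq> 0"
      using triple[of k i j] that by (simp add: inner_commute)
    moreover have "(?a k \<times> ?a l) \<bullet> ?a k = 0" by (simp add: dot_cross_self inner_commute)
    ultimately show "join (aff (A i)) (aff (A j)) \<noteq> join (aff (A k)) (aff (A l))"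
      using 1 2 by auto
  qed
  have rat: "ratio (A i) (D k) (A j) = - (n k \<bullet> ?a i) / (n k \<bullet> ?a j)"
    if "i = k - 1" "j = k + 1" "i \<noteq> j" "k \<noteq> j" for i j k
    unfolding D that(1,2) using that nz[of j k] by (intro ratio_meet_join n A_ne) auto
  \<comment> \<open>\<open>X\<close> collects the denominators of the four ratios and
    \<open>Y\<close> the numerators; the four minus signs cancel.\<close>
  define X where "X = (n 1 \<bullet> ?a 2) * (n 2 \<bullet> ?a 3) * (n 3 \<bullet> ?a 4) * (n 4 \<bullet> ?a 1)"
  define Y where "Y = (n 1 \<bullet> ?a 4) * (n 4 \<bullet> ?a 3) * (n 3 \<bullet> ?a 2) * (n 2 \<bullet> ?a 1)"
  have "X \<noteq> 0" unfolding X_def by (simp add: nz)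
  have "ratio (A 1) (D 2) (A 3) * ratio (A 2) (D 3) (A 4) *
      ratio (A 3) (D 4) (A 1) * ratio (A 4) (D 1) (A 2) = Y / X"
    by (simp add: rat X_def Y_def mult_ac)
  then have i: "ratio (A 1) (D 2) (A 3) * ratio (A 2) (D 3) (A 4) *
      ratio (A 3) (D 4) (A 1) * ratio (A 4) (D 1) (A 2) = 1 \<longleftrightarrow> X = Y"
    using \<open>X \<noteq> 0\<close> by auto
  have "proj_collinear {meet (g 1) (g 2), meet (g 3) (g 4),
      meet (join (aff (A 1)) (aff (A 4))) (join (aff (A 2)) (aff (A 3)))} \<longleftrightarrow>
      (n 1 \<times> n 2) \<bullet> ((n 3 \<times> n 4) \<times> ((?a 1 \<times> ?a 4) \<times> (?a 2 \<times> ?a 3))) = 0"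
    by (intro proj_collinear_iff m s) simp_all
  also have "(n 1 \<times> n 2) \<bullet> ((n 3 \<times> n 4) \<times> ((?a 1 \<times> ?a 4) \<times> (?a 2 \<times> ?a 3))) = X - Y"
    unfolding X_def Y_def by (intro meets_collinear_identity triple na) simp_all
  finally have ii: "proj_collinear {meet (g 1) (g 2), meet (g 3) (g 4),
      meet (join (aff (A 1)) (aff (A 4))) (join (aff (A 2)) (aff (A 3)))} \<longleftrightarrow> X = Y"
    by simp
  \<comment> \<open>Meets and joins are symmetric, so (iii) can be reordered into the literal image
    of (ii) under exchanging 2 and 4. The same identity then applies with \<open>X\<close> and
    \<open>Y\<close> interchanged.\<close>
  have "{meet (g 1) (g 4), meet (g 2) (g 3),
      meet (join (aff (A 1)) (aff (A 2))) (join (aff (A 3)) (aff (A 4)))} =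
    {meet (g 1) (g 4), meet (g 3) (g 2),
      meet (join (aff (A 1)) (aff (A 2))) (join (aff (A 4)) (aff (A 3)))}"
    by (simp add: join_commute meet_def conj_commute)
  then have "proj_collinear {meet (g 1) (g 4), meet (g 2) (g 3),
      meet (join (aff (A 1)) (aff (A 2))) (join (aff (A 3)) (aff (A 4)))} \<longleftrightarrow>
    proj_collinear {meet (g 1) (g 4), meet (g 3) (g 2),
      meet (join (aff (A 1)) (aff (A 2))) (join (aff (A 4)) (aff (A 3)))}"
    by (rule arg_cong)
  also have "\<dots> \<longleftrightarrow> (n 1 \<times> n 4) \<bullet> ((n 3 \<times> n 2) \<times> ((?a 1 \<times> ?a 2) \<times> (?a 4 \<times> ?a 3))) = 0"
    by (intro proj_collinear_iff m s) simp_all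
  also have "(n 1 \<times> n 4) \<bullet> ((n 3 \<times> n 2) \<times> ((?a 1 \<times> ?a 2) \<times> (?a 4 \<times> ?a 3))) = Y - X"
    unfolding X_def Y_def by (intro meets_collinear_identity triple na) simp_all
  finally have iii: "proj_collinear {meet (g 1) (g 4), meet (g 2) (g 3),
      meet (join (aff (A 1)) (aff (A 2))) (join (aff (A 3)) (aff (A 4)))} \<longleftrightarrow> X = Y"
    by auto
  show ?thesis using i ii iii by blast
qed

end
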